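(* Let $N>1$, let $\mathcal{X}\subseteq\mathbb{R}^N$ be a finite set, and let $f_e:\mathbb{R}^N\to\mathbb{R}$ (encoder) and $f_d:\mathbb{R}\to\mathbb{R}^N$ (decoder) be Lipschitz continuous with constants $K_e>0$ and $K_d>0$ respectively, where $K_eK_d\ge 1$. Assume that there is a constant $B\ge 0$ with $\|\bm{x}-f_d(f_e(\bm{x}))\|\le B$ for all $\bm{x}\in\mathcal{X}$, and that for every $\bm{x}\in\mathcal{X}$ there exists at least one $h^*\in\mathbb{R}$ with $f_d(h^* )=\bm{x}$. Let $\bm{x_i},\bm{x_j}\in\mathcal{X}$ be two distinct points, and let $h_i=f_e(\bm{x_i})$ and $h_j=f_e(\bm{x_j})$. If $|h_i-h_j|\le\epsilon$, where $\epsilon>0$ is a constant, then $$\|\bm{x_i}-\bm{x_j}\|\le 2B+K_d\,\epsilon .$$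
   Context: $\|\cdot\|$ is the Euclidean norm on $\mathbb{R}^N$. A map $f$ is Lipschitz continuous with constant $K$ if $\|f(u)-f(v)\|\le K\|u-v\|$ for all $u,v$ in its domain. The value $h_i=f_e(\bm{x_i})$ is called the latent representation of $\bm{x_i}$, and $\hat{\bm{x_i}}=f_d(h_i)$ its reconstruction. *)

theory Defs
  imports "HOL-Analysis.Analysis"
begin

end

theory Submission
  imports Defs
begin

text \<open>Walk from \<open>x_i\<close> to \<open>x_j\<close> through the two reconstructions
  \<open>f_d h_i\<close> and \<open>f_d h_j\<close>. The outer legs are reconstruction errors, each
  at most \<open>B\<close>; the middle leg joins decoder images of latent values at most
  \<open>\<epsilon>\<close> apart, so the Lipschitz bound on \<open>f_d\<close> gives at most
  \<open>K_d * \<epsilon>\<close>. The triangle inequality adds the three legs.\<close>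

theorem theoremC1:
  fixes X :: "(real ^ 'n) set"
    and f_e :: "real ^ 'n \<Rightarrow> real"
    and f_d :: "real \<Rightarrow> real ^ 'n"
    and K_e K_d B \<epsilon> :: real
    and x_i x_j :: "real ^ 'n"
    and h_i h_j :: real
  assumes "CARD('n) > 1"
    and "finite X"
    and "K_e > 0" and "K_d > 0"
    and "K_e-lipschitz_on UNIV f_e"
    and "K_d-lipschitz_on UNIV f_d"
    and "K_e * K_d \<ge> 1"
    and "B \<ge> 0"
    and "\<forall>x\<in>X. norm (x - f_d (f_e x)) \<le> B"
    and "\<forall>x\<in>X. \<exists>h. f_d h = x"
    and "x_i \<in> X" and "x_j \<in> X" and "x_i \<noteq> x_j"
    and "h_i = f_e x_i" and "h_j = f_e x_j"
    and "\<epsilon> > 0"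
    and "\<bar>h_i - h_j\<bar> \<le> \<epsilon>"
  shows "norm (x_i - x_j) \<le> 2 * B + K_d * \<epsilon>"
proof -
  \<comment> \<open>The second distance is written in reverse order so that both fit the chain from
    \<open>x_i\<close> to \<open>x_j\<close>; symmetry of the norm accounts for the flip.\<close>
  have i: "dist x_i (f_d h_i) \<le> B" and j: "dist (f_d h_j) x_j \<le> B"
    using assms(9,11,12,14,15) by (auto simp: dist_norm norm_minus_commute)
  have "dist (f_d h_i) (f_d h_j) \<le> K_d * dist h_i h_j"
    using assms(6) by (rule lipschitz_onD) simp_all
  \<comment> \<open>Positivity of \<open>K_d\<close> allows the latent bound to be scaled.\<close>
  also have "\<dots> \<le> K_d * \<epsilon>"
    using assms(4,17) by (simp add: dist_real_def)
  finally have "dist (f_d h_i) (f_d h_j) \<le> K_d * \<epsilon>" .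
  \<comment> \<open>The triangle inequality is used twice: a detour through \<open>f_d h_i\<close>,
    then one through \<open>f_d h_j\<close> on the remaining leg.\<close>
  moreover have "dist x_i x_j \<le> dist x_i (f_d h_i) + dist (f_d h_i) (f_d h_j) + dist (f_d h_j) x_j"
    using dist_triangle[of x_i x_j "f_d h_i"] dist_triangle[of "f_d h_i" x_j "f_d h_j"] by linarith
  ultimately show ?thesis
    using i j by (simp add: dist_norm)
qed

end
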